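(* Let $(X,P_X)$ and $(B,P_B)$ be right-preordered groups and let $\varphi\colon B\to\mathrm{Aut}(X)$, $b\mapsto\varphi_b$, be an action of the group $B$ on the group $X$ by group automorphisms. If $B$ is a right-ordered group (i.e. its preorder is antisymmetric), then $$P_{\mathrm{lex}}=\{(x,b)\in X\rtimes_\varphi B \mid b>0 \text{ or } (b\sim 0 \text{ and } x\geq 0)\}$$ is (the positive cone of) a compatible right-preorder on $X\rtimes_\varphi B$.
   Context: Groups are written additively but need not be abelian. A right-preordered group is a group $X$ with a preorder (reflexive and transitive relation) $\leq$ such that $x\leq y$ implies $x+z\leq y+z$ for all $x,y,z\in X$. Its positive cone is the submonoid $P_X=\{x\in X\mid x\geq 0\}$; right-preorders on a group correspond bijectively to submonoids via $x\leq y\Leftrightarrow y-x\in P_X$, and a right-preorder is identified with its positive cone. $\mathbf{ROrdGrp}$ is the category of right-preordered groups and monotone group homomorphisms. We write $b\sim 0$ for ($b\leq 0$ and $0\leq b$), and $b>0$ for ($b\geq 0$ and not $b\sim 0$). The semidirect product $X\rtimes_\varphi B$ is the set $X\times B$ with operation $(x,b)+(y,b')=(x+\varphi_b(y),b+b')$. Let $\langle 1,0\rangle\colon X\to X\rtimes_\varphi B$, $x\mapsto(x,0)$; $\pi_B\colon X\rtimes_\varphi B\to B$, $(x,b)\mapsto b$; $\langle 0,1\rangle\colon B\to X\rtimes_\varphi B$, $b\mapsto (0,b)$. A right-preorder on the group $X\rtimes_\varphi B$ (equivalently, a submonoid $P$) is called compatible if these maps form a split extension in $\mathbf{ROrdGrp}$,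 i.e. $\pi_B$ and $\langle 0,1\rangle$ are monotone and $\langle 1,0\rangle$ is the kernel of $\pi_B$ in $\mathbf{ROrdGrp}$ (the latter meaning that $(x,0)\in P$ if and only if $x\in P_X$). *)

theory Defs
  imports "HOL-Algebra.Bij" "HOL-Algebra.Coset"
begin

text \<open>
  Groups are HOL-Algebra groups, hence written multiplicatively and not assumed commutative:
  \<open>\<one>\<close>, \<open>\<otimes>\<close> and \<open>inv\<close> stand for \<open>0\<close>, \<open>+\<close> and \<open>-\<close> in the additive notation that is usual
  for preordered groups. A preorder on \<open>G\<close> is a relation \<open>r\<close>, with \<open>(x, y) \<in> r\<close> for \<open>x \<le> y\<close>.
\<close>

locale right_preordered_group = group G for G (structure) +
  fixes r :: "'a rel"
  assumes preorder: "preorder_on (carrier G) r"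
    and right_translation:
      "\<lbrakk>x \<in> carrier G; y \<in> carrier G; z \<in> carrier G; (x, y) \<in> r\<rbrakk> \<Longrightarrow> (x \<otimes> z, y \<otimes> z) \<in> r"

locale right_ordered_group = right_preordered_group +
  assumes antisymmetric: "antisym r"

definition pos_cone :: "('a, 'm) monoid_scheme \<Rightarrow> 'a rel \<Rightarrow> 'a set" where
  "pos_cone G r = {x \<in> carrier G. (\<one>\<^bsub>G\<^esub>, x) \<in> r}"

definition equiv_zero :: "('a, 'm) monoid_scheme \<Rightarrow> 'a rel \<Rightarrow> 'a \<Rightarrow> bool" where
  "equiv_zero G r x \<longleftrightarrow> (x, \<one>\<^bsub>G\<^esub>) \<in> r \<and> (\<one>\<^bsub>G\<^esub>, x) \<in> r"

definition strictly_pos :: "('a, 'm) monoid_scheme \<Rightarrow> 'a rel \<Rightarrow> 'a \<Rightarrow> bool" where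
  "strictly_pos G r x \<longleftrightarrow> (\<one>\<^bsub>G\<^esub>, x) \<in> r \<and> \<not> equiv_zero G r x"

definition mono_hom ::
  "('a, 'm) monoid_scheme \<Rightarrow> 'a rel \<Rightarrow> ('b, 'n) monoid_scheme \<Rightarrow> 'b rel \<Rightarrow> ('a \<Rightarrow> 'b) set" where
  "mono_hom G r H s =
    {f \<in> hom G H. monotone_on (carrier G) (\<lambda>x y. (x, y) \<in> r) (\<lambda>x y. (x, y) \<in> s) f}"

text \<open>
  \<open>k : (K, q) \<rightarrow> (G, r)\<close> is a kernel of \<open>f : G \<rightarrow> H\<close> in the category of right-preordered groups:
  it is a kernel of the underlying group homomorphism, and \<open>q\<close> is the preorder induced by \<open>r\<close>
  along \<open>k\<close>. For right-preordered groups the latter can be expressed by positive cones.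
\<close>

definition is_ROrdGrp_kernel ::
  "('k, 'l) monoid_scheme \<Rightarrow> 'k rel \<Rightarrow> ('a, 'm) monoid_scheme \<Rightarrow> 'a rel \<Rightarrow>
   ('b, 'n) monoid_scheme \<Rightarrow> ('k \<Rightarrow> 'a) \<Rightarrow> ('a \<Rightarrow> 'b) \<Rightarrow> bool" where
  "is_ROrdGrp_kernel K q G r H k f \<longleftrightarrow>
     k \<in> mono_hom K q G r \<and>
     inj_on k (carrier K) \<and>
     k ` carrier K = kernel G H f \<and>
     (\<forall>x\<in>carrier K. k x \<in> pos_cone G r \<longleftrightarrow> x \<in> pos_cone K q)"

definition split_extension ::
  "('x, 'l) monoid_scheme \<Rightarrow> 'x rel \<Rightarrow> ('a, 'm) monoid_scheme \<Rightarrow> 'a rel \<Rightarrow>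
   ('b, 'n) monoid_scheme \<Rightarrow> 'b rel \<Rightarrow> ('x \<Rightarrow> 'a) \<Rightarrow> ('a \<Rightarrow> 'b) \<Rightarrow> ('b \<Rightarrow> 'a) \<Rightarrow> bool" where
  "split_extension X rX A rA B rB k p s \<longleftrightarrow>
     right_preordered_group X rX \<and> right_preordered_group A rA \<and> right_preordered_group B rB \<and>
     p \<in> mono_hom A rA B rB \<and>
     s \<in> mono_hom B rB A rA \<and>
     (\<forall>b\<in>carrier B. p (s b) = b) \<and>
     is_ROrdGrp_kernel X rX A rA B k p"

definition semidirect ::
  "('x, 'm) monoid_scheme \<Rightarrow> ('b \<Rightarrow> 'x \<Rightarrow> 'x) \<Rightarrow> ('b, 'n) monoid_scheme \<Rightarrow> ('x \<times> 'b) monoid" where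
  "semidirect X \<phi> B =
     \<lparr>carrier = carrier X \<times> carrier B,
      monoid.mult = (\<lambda>(x, b) (y, b'). (x \<otimes>\<^bsub>X\<^esub> \<phi> b y, b \<otimes>\<^bsub>B\<^esub> b')),
      one = (\<one>\<^bsub>X\<^esub>, \<one>\<^bsub>B\<^esub>)\<rparr>"

definition compatible_right_preorder ::
  "('x, 'm) monoid_scheme \<Rightarrow> 'x rel \<Rightarrow> ('b, 'n) monoid_scheme \<Rightarrow> 'b rel \<Rightarrow>
   ('b \<Rightarrow> 'x \<Rightarrow> 'x) \<Rightarrow> ('x \<times> 'b) rel \<Rightarrow> bool" where
  "compatible_right_preorder X rX B rB \<phi> r \<longleftrightarrow>
     right_preordered_group (semidirect X \<phi> B) r \<and>
     split_extension X rX (semidirect X \<phi> B) r B rB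
       (\<lambda>x. (x, \<one>\<^bsub>B\<^esub>)) (\<lambda>(x, b). b) (\<lambda>b. (\<one>\<^bsub>X\<^esub>, b))"

definition P_lex ::
  "('x, 'm) monoid_scheme \<Rightarrow> 'x rel \<Rightarrow> ('b, 'n) monoid_scheme \<Rightarrow> 'b rel \<Rightarrow>
   ('b \<Rightarrow> 'x \<Rightarrow> 'x) \<Rightarrow> ('x \<times> 'b) set" where
  "P_lex X rX B rB \<phi> =
     {(x, b). (x, b) \<in> carrier (semidirect X \<phi> B) \<and>
        (strictly_pos B rB b \<or> (equiv_zero B rB b \<and> (\<one>\<^bsub>X\<^esub>, x) \<in> rX))}"

end

theory Submission
  imports Defs
begin

text \<open>
  The lexicographic relation, \<open>(x, b) \<le> (y, c)\<close> iff \<open>b < c\<close> or \<open>b = c\<close> and \<open>x \<le> y\<close>, is invariant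
  under right translation by \<open>(z, d)\<close>: the translates are \<open>(x \<otimes> \<phi> b z, b \<otimes> d)\<close> and
  \<open>(y \<otimes> \<phi> c z, c \<otimes> d)\<close>, and the first components are compared only if \<open>b = c\<close>, in which
  case both are multiplied by the same element \<open>\<phi> b z\<close>. Antisymmetry of \<open>B\<close> makes the
  relation transitive and identifies its positive cone with \<open>P_lex\<close>.
\<close>

lemma semidirect_simps [simp]:
  "carrier (semidirect X \<phi> B) = carrier X \<times> carrier B"
  "(x, b) \<otimes>\<^bsub>semidirect X \<phi> B\<^esub> (y, c) = (x \<otimes>\<^bsub>X\<^esub> \<phi> b y, b \<otimes>\<^bsub>B\<^esub> c)"
  "\<one>\<^bsub>semidirect X \<phi> B\<^esub> = (\<one>\<^bsub>X\<^esub>, \<one>\<^bsub>B\<^esub>)"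
  by (simp_all add: semidirect_def)

lemma right_preordered_groupD:
  assumes "right_preordered_group G r"
  shows "group G" "refl_on (carrier G) r" "trans r" "r \<subseteq> carrier G \<times> carrier G"
  using assms
  by (auto simp: right_preordered_group_def right_preordered_group_axioms_def preorder_on_def)

locale group_action_by_automorphisms = X: group X + B: group B
  for X :: "('x, 'm) monoid_scheme" and B :: "('b, 'n) monoid_scheme" +
  fixes \<phi> :: "'b \<Rightarrow> 'x \<Rightarrow> 'x"
  assumes action_hom: "\<phi> \<in> hom B (AutoGroup X)"
begin

lemma action_in_auto: "b \<in> carrier B \<Longrightarrow> \<phi> b \<in> auto X"
  using action_hom by (auto simp: hom_def AutoGroup_def)

lemma action_closed [simp]: "b \<in> carrier B \<Longrightarrow> x \<in> carrier X \<Longrightarrow> \<phi> b x \<in> carrier X"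
  using action_in_auto by (auto simp: auto_def hom_def)

lemma action_mult:
  "\<lbrakk>b \<in> carrier B; x \<in> carrier X; y \<in> carrier X\<rbrakk> \<Longrightarrow> \<phi> b (x \<otimes>\<^bsub>X\<^esub> y) = \<phi> b x \<otimes>\<^bsub>X\<^esub> \<phi> b y"
  using action_in_auto by (auto simp: auto_def hom_def)

lemma action_one [simp]:
  assumes "b \<in> carrier B" shows "\<phi> b \<one>\<^bsub>X\<^esub> = \<one>\<^bsub>X\<^esub>"
  using action_in_auto[OF assms] by (auto simp: auto_def intro: hom_one X.is_group)

text \<open>The product of \<open>AutoGroup X\<close> is composition restricted to
  \<open>carrier X\<close>, so the action law is read off pointwise on the carrier.\<close>

lemma action_comp:
  assumes "b \<in> carrier B" "c \<in> carrier B" "x \<in> carrier X"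
  shows "\<phi> (b \<otimes>\<^bsub>B\<^esub> c) x = \<phi> b (\<phi> c x)"
proof -
  have "\<phi> (b \<otimes>\<^bsub>B\<^esub> c) = \<phi> b \<otimes>\<^bsub>AutoGroup X\<^esub> \<phi> c"
    using action_hom assms by (simp add: hom_def)
  also have "\<dots> = compose (carrier X) (\<phi> b) (\<phi> c)"
    using action_in_auto assms by (simp add: AutoGroup_def BijGroup_def auto_def)
  finally show ?thesis
    using assms by (simp add: compose_def)
qed

lemma action_by_one [simp]:
  assumes "x \<in> carrier X" shows "\<phi> \<one>\<^bsub>B\<^esub> x = x"
proof -
  have "\<phi> \<one>\<^bsub>B\<^esub> = \<one>\<^bsub>AutoGroup X\<^esub>"
    by (rule hom_one[OF action_hom B.is_group X.AutoGroup])
  then show ?thesis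
    using assms by (simp add: AutoGroup_def BijGroup_def)
qed

lemma semidirect_group: "group (semidirect X \<phi> B)"
proof (rule groupI)
  fix p assume "p \<in> carrier (semidirect X \<phi> B)"
  then obtain x b where p: "p = (x, b)" "x \<in> carrier X" "b \<in> carrier B"
    by auto
  \<comment> \<open>\<open>groupI\<close> asks only for a left inverse. Its second component must be
    \<open>?i\<close>, so its first must cancel \<open>\<phi> ?i x\<close>;
    \<open>action_mult\<close> read backwards merges the two factors into \<open>\<phi> ?i\<close>
    of the identity.\<close>
  let ?i = "inv\<^bsub>B\<^esub> b"
  have "(\<phi> ?i (inv\<^bsub>X\<^esub> x), ?i) \<otimes>\<^bsub>semidirect X \<phi> B\<^esub> p = \<one>\<^bsub>semidirect X \<phi> B\<^esub>"
    using p by (simp add: action_mult[symmetric])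
  then show "\<exists>q\<in>carrier (semidirect X \<phi> B). q \<otimes>\<^bsub>semidirect X \<phi> B\<^esub> p = \<one>\<^bsub>semidirect X \<phi> B\<^esub>"
    using p by (intro bexI[of _ "(\<phi> ?i (inv\<^bsub>X\<^esub> x), ?i)"]) auto
qed (auto simp: action_mult action_comp X.m_assoc B.m_assoc)

end

text \<open>For reflexive \<open>rX\<close>, \<open>(x, x) \<in> rX\<close> says that \<open>x\<close> is in the carrier.\<close>

definition lex_preorder :: "'x rel \<Rightarrow> 'b set \<Rightarrow> 'b rel \<Rightarrow> ('x \<times> 'b) rel" where
  "lex_preorder rX B rB =
     {((x, b), (y, c)). (x, x) \<in> rX \<and> (y, y) \<in> rX \<and> b \<in> B \<and> c \<in> B \<and>
        ((b, c) \<in> rB \<and> b \<noteq> c \<or> b = c \<and> (x, y) \<in> rX)}"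

theorem corollary4p3:
  fixes X :: "('x, 'm) monoid_scheme" and rX :: "'x rel"
    and B :: "('b, 'n) monoid_scheme" and rB :: "'b rel"
    and \<phi> :: "'b \<Rightarrow> 'x \<Rightarrow> 'x"
  assumes "right_preordered_group X rX"
    and "right_preordered_group B rB"
    and "\<phi> \<in> hom B (AutoGroup X)"
    and "right_ordered_group B rB"
  shows "\<exists>r. compatible_right_preorder X rX B rB \<phi> r \<and>
             pos_cone (semidirect X \<phi> B) r = P_lex X rX B rB \<phi>"
proof -
  interpret X: right_preordered_group X rX by fact
  interpret B: right_ordered_group B rB by fact
  interpret group_action_by_automorphisms X B \<phi>
    by unfold_locales fact
  note X = right_preordered_groupD[OF assms(1)]
  note B = right_preordered_groupD[OF assms(2)]
  have refl: "(x, x) \<in> rX \<longleftrightarrow> x \<in> carrier X" "b \<in> carrier B \<Longrightarrow> (b, b) \<in> rB" for x b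
    using X(2,4) B(2) by (auto simp: refl_on_def)
  let ?S = "semidirect X \<phi> B"
  let ?r = "lex_preorder rX (carrier B) rB"
  \<comment> \<open>The critical case is a chain of two strict steps in \<open>B\<close>: if its
    ends coincided, antisymmetry would make the middle element equal to them.\<close>
  have "trans ?r"
    unfolding lex_preorder_def
    using X(3) B(3) B.antisymmetric
    by (auto intro!: transI dest: transD antisymD)
  then have "preorder_on (carrier ?S) ?r"
    by (auto simp: preorder_on_def refl_on_def lex_preorder_def refl)
  \<comment> \<open>Cancellation in \<open>B\<close> keeps distinct second components distinct after
    translation.\<close>
  moreover have "(p \<otimes>\<^bsub>?S\<^esub> t, q \<otimes>\<^bsub>?S\<^esub> t) \<in> ?r"
    if "p \<in> carrier ?S" "q \<in> carrier ?S" "t \<in> carrier ?S" "(p, q) \<in> ?r" for p q t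
    using that by (auto simp: lex_preorder_def refl X.right_translation B.right_translation)
  ultimately have S: "right_preordered_group ?S ?r"
    using semidirect_group
    by (simp add: right_preordered_group_def right_preordered_group_axioms_def)
  have "(\<lambda>(x, b). b) \<in> mono_hom ?S ?r B rB"
    by (auto simp: mono_hom_def hom_def monotone_on_def lex_preorder_def refl)
  moreover have "(\<lambda>b. (\<one>\<^bsub>X\<^esub>, b)) \<in> mono_hom B rB ?S ?r"
    by (auto simp: mono_hom_def hom_def monotone_on_def lex_preorder_def refl)
  \<comment> \<open>Over the identity of \<open>B\<close> only the clause \<open>b = c\<close> can
    apply, so \<open>rX\<close> is what remains on the kernel. The embedding is a homomorphism
    because the identity of \<open>B\<close> acts trivially.\<close>
  moreover have "is_ROrdGrp_kernel X rX ?S ?r B (\<lambda>x. (x, \<one>\<^bsub>B\<^esub>)) (\<lambda>(x, b). b)"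
    by (auto simp: is_ROrdGrp_kernel_def mono_hom_def hom_def monotone_on_def lex_preorder_def
        refl pos_cone_def kernel_def inj_on_def)
  ultimately have "compatible_right_preorder X rX B rB \<phi> ?r"
    using S assms(1,2) by (simp add: compatible_right_preorder_def split_extension_def)
  \<comment> \<open>By antisymmetry \<open>equiv_zero B rB b\<close> means that \<open>b\<close> is
    the identity, so \<open>strictly_pos\<close> matches the clause with distinct second
    components.\<close>
  moreover have "pos_cone ?S ?r = P_lex X rX B rB \<phi>"
    using B.antisymmetric
    by (auto simp: pos_cone_def P_lex_def lex_preorder_def strictly_pos_def equiv_zero_def refl
        dest: antisymD)
  ultimately show ?thesis
    by blast
qed

end
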